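(* Let $\mathcal{G}=(\mathcal{V},\mathcal{E})$ be a bipartite graph with weights $\mathcal{W}=\{w_{ij}\in\mathbb{R}\mid (i,j)\in\mathcal{E}\}$, and let $\Pi^*=\{\pi^*_{ij}\mid (i,j)\in\mathcal{E}\}\in LAP(\mathcal{G},\mathcal{W})$ be its (unique) optimal assignment. Let $\Delta=\{\delta_{ij}\in\mathbb{R}\mid (i,j)\in\mathcal{E}\}$ be an allowable perturbation, i.e. $\Pi^*\in LAP(\mathcal{G},\mathcal{W}+\Delta)$. Let $\Delta'=\{\delta'_{ij}\in\mathbb{R}\mid (i,j)\in\mathcal{E}\}$ be another perturbation such that $$\delta'_{ij}\le\delta_{ij}\ \text{ for all }(i,j)\in\mathcal{E}\text{ with }\pi^*_{ij}=1,\qquad \delta'_{ij}\ge\delta_{ij}\ \text{ for all }(i,j)\in\mathcal{E}\text{ with }\pi^*_{ij}=0.$$ Then $\Delta'$ is an allowable perturbation, i.e. $\Pi^*\in LAP(\mathcal{G},\mathcal{W}+\Delta')$.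
   Context: $\mathcal{G}=(\mathcal{V},\mathcal{E})$ is a finite bipartite graph with $\mathcal{V}=\mathcal{V}_A\cup\mathcal{V}_T$, $\mathcal{V}_A\cap\mathcal{V}_T=\emptyset$, $\mathcal{E}\subseteq\mathcal{V}_A\times\mathcal{V}_T$ and $|\mathcal{V}_A|\ge|\mathcal{V}_T|$ ($\mathcal{V}_A$ = agents, $\mathcal{V}_T$ = tasks). Edge weights are real numbers $w_{ij}$, $(i,j)\in\mathcal{E}$. An assignment is a family $\Pi=\{\pi_{ij}\in\{0,1\}\mid (i,j)\in\mathcal{E}\}$ satisfying $\sum_{i:(i,j)\in\mathcal{E}}\pi_{ij}=1$ for every $j\in\mathcal{V}_T$ and $\sum_{j:(i,j)\in\mathcal{E}}\pi_{ij}\le 1$ for every $i\in\mathcal{V}_A$. Its cost is $f(\mathcal{W},\Pi)=\sum_{(i,j)\in\mathcal{E}}\pi_{ij}w_{ij}$. $LAP(\mathcal{G},\mathcal{W})$ denotes the set of assignments minimizing $f(\mathcal{W},\cdot)$ over all assignments. Standing assumption: the optimal assignment for the initial weights is unique, i.e. $LAP(\mathcal{G},\mathcal{W})=\{\Pi^*\}$. A perturbation is a family of real numbers $\Delta=\{\delta_{ij}\mid (i,j)\in\mathcal{E}\}$, and $\mathcal{W}+\Delta:=\{w_{ij}+\delta_{ij}\mid (i,j)\in\mathcal{E}\}$. A perturbation $\Delta$ is called allowable if $\Pi^*\in LAP(\mathcal{G},\mathcal{W}+\Delta)$ (the optimizer for the perturbed weights need not be unique). *)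

theory Defs
  imports Complex_Main "HOL-Library.FuncSet"
begin

locale assignment_graph =
  fixes VA VT :: "'v set" and E :: "('v \<times> 'v) set"
  assumes finite_VA: "finite VA"
    and finite_VT: "finite VT"
    and disjoint: "VA \<inter> VT = {}"
    and edges: "E \<subseteq> VA \<times> VT"
    and card_le: "card VT \<le> card VA"

(* A family indexed by the edges is a function on pairs. Assignments are extensional (PiE), so
   that two assignments agreeing on E are equal and uniqueness of the optimum is meaningful.
   Weights and perturbations are arbitrary functions; their values off E are never used. *)
definition assignments :: "'v set \<Rightarrow> 'v set \<Rightarrow> ('v \<times> 'v) set \<Rightarrow> ('v \<times> 'v \<Rightarrow> real) set" where
  "assignments VA VT E = {\<pi> \<in> E \<rightarrow>\<^sub>E {0, 1}.
     (\<forall>j\<in>VT. (\<Sum>i | (i, j) \<in> E. \<pi> (i, j)) = 1) \<and>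
     (\<forall>i\<in>VA. (\<Sum>j | (i, j) \<in> E. \<pi> (i, j)) \<le> 1)}"

definition assignment_cost ::
    "('v \<times> 'v) set \<Rightarrow> ('v \<times> 'v \<Rightarrow> real) \<Rightarrow> ('v \<times> 'v \<Rightarrow> real) \<Rightarrow> real" where
  "assignment_cost E w \<pi> = (\<Sum>e\<in>E. \<pi> e * w e)"

definition LAP ::
    "'v set \<Rightarrow> 'v set \<Rightarrow> ('v \<times> 'v) set \<Rightarrow> ('v \<times> 'v \<Rightarrow> real) \<Rightarrow> ('v \<times> 'v \<Rightarrow> real) set" where
  "LAP VA VT E w =
     {\<pi>. is_arg_min (assignment_cost E w) (\<lambda>\<rho>. \<rho> \<in> assignments VA VT E) \<pi>}"

definition allowable ::
    "'v set \<Rightarrow> 'v set \<Rightarrow> ('v \<times> 'v) set \<Rightarrow> ('v \<times> 'v \<Rightarrow> real) \<Rightarrow> ('v \<times> 'v \<Rightarrow> real)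
      \<Rightarrow> ('v \<times> 'v \<Rightarrow> real) \<Rightarrow> bool" where
  "allowable VA VT E w \<pi>opt \<delta> \<longleftrightarrow> \<pi>opt \<in> LAP VA VT E (\<lambda>e. w e + \<delta> e)"

end

theory Submission
  imports Defs
begin

text \<open>
  Passing from \<open>\<delta>\<close> to \<open>\<delta>'\<close> changes the cost of an assignment \<open>\<rho>\<close> by the sum of
  \<open>\<rho> e * (\<delta>' e - \<delta> e)\<close> over the edges. The sign conditions say that each summand is smallest
  at \<open>\<rho> = \<pi>opt\<close>, among all values of \<open>\<rho> e\<close> in \<open>{0, 1}\<close>, so an optimal \<open>\<pi>opt\<close> stays optimal.
\<close>

lemma assignment_cost_add:
  "assignment_cost E (\<lambda>e. u e + v e) \<pi> = assignment_cost E u \<pi> + assignment_cost E v \<pi>"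
  by (simp add: assignment_cost_def distrib_left sum.distrib)

lemma assignments_edge_cases:
  assumes "\<pi> \<in> assignments VA VT E" and "e \<in> E"
  obtains "\<pi> e = 0" | "\<pi> e = 1"
  using assms by (auto simp: assignments_def PiE_iff)

text \<open>\<open>is_arg_min\<close> only says that no assignment is strictly cheaper; since the
  reals are linearly ordered, this is a comparison with every assignment.\<close>

lemma LAP_iff:
  "\<pi> \<in> LAP VA VT E w \<longleftrightarrow> \<pi> \<in> assignments VA VT E \<and>
    (\<forall>\<rho>\<in>assignments VA VT E. assignment_cost E w \<pi> \<le> assignment_cost E w \<rho>)"
  by (auto simp: LAP_def is_arg_min_linorder)

theorem theorem1:
  fixes VA VT :: "'v set" and E :: "('v \<times> 'v) set"
    and w \<pi>opt \<delta> \<delta>' :: "'v \<times> 'v \<Rightarrow> real"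
  assumes "assignment_graph VA VT E"
    and "LAP VA VT E w = {\<pi>opt}"
    and "allowable VA VT E w \<pi>opt \<delta>"
    and "\<And>i j. (i, j) \<in> E \<Longrightarrow> \<pi>opt (i, j) = 1 \<Longrightarrow> \<delta>' (i, j) \<le> \<delta> (i, j)"
    and "\<And>i j. (i, j) \<in> E \<Longrightarrow> \<pi>opt (i, j) = 0 \<Longrightarrow> \<delta>' (i, j) \<ge> \<delta> (i, j)"
  shows "allowable VA VT E w \<pi>opt \<delta>'"
proof -
  define d where "d e = \<delta>' e - \<delta> e" for e
  have split: "assignment_cost E (\<lambda>e. w e + \<delta>' e) \<rho> =
      assignment_cost E (\<lambda>e. w e + \<delta> e) \<rho> + assignment_cost E d \<rho>" for \<rho>
    by (simp add: d_def flip: assignment_cost_add)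
  have opt: "\<pi>opt \<in> assignments VA VT E"
    and min: "\<And>\<rho>. \<rho> \<in> assignments VA VT E \<Longrightarrow>
      assignment_cost E (\<lambda>e. w e + \<delta> e) \<pi>opt \<le> assignment_cost E (\<lambda>e. w e + \<delta> e) \<rho>"
    using assms(3) by (auto simp: allowable_def LAP_iff)
  have "assignment_cost E d \<pi>opt \<le> assignment_cost E d \<rho>"
    if \<rho>: "\<rho> \<in> assignments VA VT E" for \<rho>
    unfolding assignment_cost_def
  proof (rule sum_mono)
    fix e assume e: "e \<in> E"
    have "\<pi>opt e = 1 \<Longrightarrow> d e \<le> 0" "\<pi>opt e = 0 \<Longrightarrow> 0 \<le> d e"
      using assms(4,5) e by (cases e; simp add: d_def)+
    \<comment> \<open>Where the two assignments agree there is equality. Values 1 and 0 of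
      \<open>\<pi>opt\<close> and \<open>\<rho>\<close> leave \<open>d e \<le> 0\<close>, values 0
      and 1 leave \<open>0 \<le> d e\<close>.\<close>
    then show "\<pi>opt e * d e \<le> \<rho> e * d e"
      by (rule_tac assignments_edge_cases[OF opt e];
          rule_tac assignments_edge_cases[OF \<rho> e]; simp)
  qed
  \<comment> \<open>Adding this to the optimality inequality for \<delta> gives the one for
    \<delta>'.\<close>
  then show ?thesis
    using opt min by (auto simp: allowable_def LAP_iff split intro: add_mono)
qed

end
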